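(* Let $\{X^k\}$ be the sequence of sets produced by FPD_NMT (the algorithm described in the context, run without stopping criterion) started from a set $X^0\subset\Omega$ of mutually nondominated points. Suppose that: (1) [same worst set] for all iterations $k>0$, the sets $\bar X^{l(k-1)}$ and $X^{l(k)}$ selected by the algorithm are equal; (2) [processing order] at each iteration $k$, the first point of $X^k$ to be processed in the for loop belongs to $\arg\min_{x\in X^k}\theta(x)$; (3) there is a point $x_0\in X^0$ such that the set $\mathcal L(x_0)=\bigcup_{j=1}^m\{x\in\Omega\mid f_j(x)\le f_j(x_0)\}$ is compact. Then there exists at least one infinite subsequence of indices $K\subseteq\{0,1,\ldots\}$ such that: (i) if $\sigma_k=\sigma>0$ for all $k$, there exists $\bar k\in K$ such that $\Theta(X^k)\ge-\sigma$ for all $k\in K$ with $k\ge\bar k$; (ii) if $\sigma_k\to0$, then $\lim_{k\in K,\,k\to\infty}\Theta(X^k)=0$.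
   Context: **Problem and order.** $F=(f_1,\dots,f_m)^\top:\mathbb R^n\to\mathbb R^m$ is continuously differentiable; $\Omega=[l,u]\subseteq\mathbb R^n$ is a nonempty box (bounds possibly infinite). For $a,b\in\mathbb R^m$: $a\le b$ iff $a_j\le b_j$ for all $j$; $a<b$ iff $a_j<b_j$ for all $j$; $a\lneqq b$ iff $a\le b$ and $a\ne b$. A set $X\subseteq\Omega$ consists of mutually nondominated points if there are no $x,y\in X$ with $F(y)\lneqq F(x)$. $\mathbf 1$ is the all-ones vector of $\mathbb R^m$, and $\mathbb N\ni0$ in the ranges of line-search exponents. **Directions.** For $x\in\Omega$ and nonempty $I\subseteq\{1,\dots,m\}$, $v^I(x)$ and $\theta^I(x)$ are the unique minimizer and the optimal value of $\min\{\max_{j\in I}\nabla f_j(x)^\top d+\frac12\|d\|^2: d\in\mathbb R^n,\ x+d\in\Omega\}$. Write $v=v^I,\theta=\theta^I$ for $I=\{1,\dots,m\}$. Also $D(x,d)=\max_{j=1,\dots,m}\nabla f_j(x)^\top d$. **Set stationarity measure.** For a set $X\subseteq\Omega$ of mutually nondominated points, $\Theta(X)=\inf_{x\in X}\theta(x)$. **Hyper-volume.** Given a reference point $\zeta\in\mathbb R^m$ and $Y\subseteq\mathbb R^m$, $\Lambda(Y)=\{y\in\mathbb R^m\mid\exists\bar y\in Y:\bar y\le y\le\zeta\}$, and $V(Y)$ is the Lebesgue measure of $\Lambda(Y)$. For $X\subset\Omega$, $V_F(X)=V(F(X))$. When the algorithm selects sets of smallest hyper-volume at iteration $k$, the reference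 point has components $\max_{x\in X_{\rm all}}f_j(x)$, $j=1,\dots,m$, where $X_{\rm all}$ is the union of all solutions generated so far. **Algorithm FPD_NMT.** Input: finite set $X^0\subset\Omega$ of mutually nondominated points, $\alpha_0\in(0,1]$, $\delta,\gamma\in(0,1)$, a sequence $\{\sigma_k\}\subseteq\mathbb R_+$ of nonnegative reals, a positive integer $M$. Set $C^{-1}=\emptyset$. For $k=0,1,2,\dots$: 1. Choose $X^{l(k)}\in\arg\min V_F(X)$ over $X\in\{X^k,X^{k-1},\dots,X^{k-\min\{k,M\}}\}$. 2. $\bar C^k=\{x\in X^{l(k)}\cup C^{k-1}\mid\nexists y\in X^{l(k)}\cup C^{k-1}:F(y)\lneqq F(x)\}$. 3. $C^k=\bar C^k\cup\{x\in X^k\mid\forall y\in\bar C^k\ \exists j: f_j(y)<f_j(x)\}$. 4. Initialize $\hat X^k=C^k$. 5. For each $x_p\in X^k$ (for loop), if there is no $y\in\hat X^k$ (current set) with $F(y)\lneqq F(x_p)$, do: (5a) If $\theta(x_p)<-\sigma_k$: if there is $c\in\hat X^k$ with $F(x_p)\le F(c)$, let $\alpha_p^k$ be the largest $\alpha\in\{\alpha_0\delta^h:h\in\mathbb N\}$ such that there exists $c_p^k\in\hat X^k$ with $F(x_p)\le F(c_p^k)$ and $F(x_p+\alpha v(x_p))\le F(c_p^k)+\mathbf 1\gamma\alpha D(x_p,v(x_p))$; otherwise let $\alpha_p^k$ be the largest $\alpha\in\{\alpha_0\delta^h:h\in\mathbb N\}$ with $F(x_p+\alpha v(x_p))\le F(x_p)+\mathbf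 1\gamma\alpha D(x_p,v(x_p))$. If instead $\theta(x_p)\ge-\sigma_k$, set $\alpha_p^k=0$. (5b) $z_p^k=x_p+\alpha_p^kv(x_p)$. (5c) $\hat X^k\leftarrow(\hat X^k\cup\{z_p^k\})\setminus\{y\in\hat X^k\mid F(z_p^k)\lneqq F(y)\}$. (5d) For each nonempty $I\subseteq\{1,\dots,m\}$ with $\theta^I(z_p^k)<0$: if $z_p^k\in\hat X^k$, let $\alpha_p^I$ be the largest $\alpha\in\{\alpha_0\delta^h:h\in\mathbb N\}$ such that for all $y\in\hat X^k$ there is $j\in\{1,\dots,m\}$ with $f_j(z_p^k+\alpha v^I(z_p^k))<f_j(y)$; put $w=z_p^k+\alpha_p^Iv^I(z_p^k)$ and $\hat X^k\leftarrow(\hat X^k\cup\{w\})\setminus\{y\in\hat X^k\mid F(w)\lneqq F(y)\}$. 6. With $\hat X^k$ the set after the loop, choose $\bar X^{l(k)}\in\arg\min V_F(X)$ over $X\in\{\hat X^k\}\cup\{X^k,X^{k-1},\dots,X^{k-\min\{k,M-1\}}\}$. 7. $X^{k+1}=\{x\in\hat X^k\cup\bar X^{l(k)}\mid\nexists y\in\hat X^k\cup\bar X^{l(k)}:F(y)\lneqq F(x)\}$. *)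

theory Defs
  imports "HOL-Analysis.Analysis"
begin

definition ext_box :: "('n::finite \<Rightarrow> ereal) \<Rightarrow> ('n \<Rightarrow> ereal) \<Rightarrow> (real^'n) set" where
  "ext_box l u = {x. \<forall>i. l i \<le> ereal (x $ i) \<and> ereal (x $ i) \<le> u i}"

definition continuously_differentiable :: "('a::real_normed_vector \<Rightarrow> 'b::real_normed_vector) \<Rightarrow> bool" where
  "continuously_differentiable f \<longleftrightarrow>
     (\<exists>f' :: 'a \<Rightarrow> 'a \<Rightarrow>\<^sub>L 'b. (\<forall>x. (f has_derivative blinfun_apply (f' x)) (at x)) \<and> continuous_on UNIV f')"

definition grad :: "('a::real_inner \<Rightarrow> real) \<Rightarrow> 'a \<Rightarrow> 'a" where
  "grad f x = (THE g. GDERIV f x :> g)"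

text \<open>The order \<open>\<le>\<close> on \<^typ>\<open>real^'m\<close> is the componentwise one.\<close>

definition dominates :: "('a \<Rightarrow> real^'m) \<Rightarrow> 'a \<Rightarrow> 'a \<Rightarrow> bool" where
  "dominates F y x \<longleftrightarrow> F y \<le> F x \<and> F y \<noteq> F x"

definition mutually_nondominated :: "('a \<Rightarrow> real^'m) \<Rightarrow> 'a set \<Rightarrow> bool" where
  "mutually_nondominated F X \<longleftrightarrow> \<not> (\<exists>x\<in>X. \<exists>y\<in>X. dominates F y x)"

definition nondominated :: "('a \<Rightarrow> real^'m) \<Rightarrow> 'a set \<Rightarrow> 'a set" where
  "nondominated F X = {x \<in> X. \<not> (\<exists>y\<in>X. dominates F y x)}"

definition max_slope :: "(real^'n \<Rightarrow> real^'m) \<Rightarrow> 'm set \<Rightarrow> real^'n \<Rightarrow> real^'n \<Rightarrow> real" where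
  "max_slope F I x d = Max ((\<lambda>j. grad (\<lambda>y. F y $ j) x \<bullet> d) ` I)"

abbreviation D_slope :: "(real^'n \<Rightarrow> real^'m) \<Rightarrow> real^'n \<Rightarrow> real^'n \<Rightarrow> real" where
  "D_slope F \<equiv> max_slope F UNIV"

definition dir_objective :: "(real^'n \<Rightarrow> real^'m) \<Rightarrow> 'm set \<Rightarrow> real^'n \<Rightarrow> real^'n \<Rightarrow> real" where
  "dir_objective F I x d = max_slope F I x d + 1/2 * (norm d)\<^sup>2"

definition v_dir :: "(real^'n \<Rightarrow> real^'m) \<Rightarrow> (real^'n) set \<Rightarrow> 'm set \<Rightarrow> real^'n \<Rightarrow> real^'n" where
  "v_dir F \<Omega> I x = (THE d. is_arg_min (dir_objective F I x) (\<lambda>d. x + d \<in> \<Omega>) d)"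

definition theta :: "(real^'n \<Rightarrow> real^'m) \<Rightarrow> (real^'n) set \<Rightarrow> 'm set \<Rightarrow> real^'n \<Rightarrow> real" where
  "theta F \<Omega> I x = (INF d\<in>{d. x + d \<in> \<Omega>}. dir_objective F I x d)"

text \<open>The infimum is taken in \<^typ>\<open>real\<close>; it is used for finite nonempty \<open>X\<close>.\<close>

definition set_theta :: "(real^'n \<Rightarrow> real^'m) \<Rightarrow> (real^'n) set \<Rightarrow> (real^'n) set \<Rightarrow> real" where
  "set_theta F \<Omega> X = (INF x\<in>X. theta F \<Omega> UNIV x)"

definition hv_region :: "real^'m \<Rightarrow> (real^'m) set \<Rightarrow> (real^'m) set" where
  "hv_region \<zeta> Y = {y. \<exists>y'\<in>Y. y' \<le> y \<and> y \<le> \<zeta>}"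

definition hypervolume :: "real^'m \<Rightarrow> (real^'m) set \<Rightarrow> ennreal" where
  "hypervolume \<zeta> Y = emeasure lebesgue (hv_region \<zeta> Y)"

definition ref_point :: "('a \<Rightarrow> real^'m) \<Rightarrow> 'a set \<Rightarrow> real^'m" where
  "ref_point F Xall = (\<chi> j. Max ((\<lambda>x. F x $ j) ` Xall))"

definition min_hypervolume :: "('a \<Rightarrow> real^'m) \<Rightarrow> 'a set \<Rightarrow> 'a set set \<Rightarrow> 'a set \<Rightarrow> bool" where
  "min_hypervolume F Xall \<X> X \<longleftrightarrow>
     is_arg_min (\<lambda>X. hypervolume (ref_point F Xall) (F ` X)) (\<lambda>X. X \<in> \<X>) X"

text \<open>
  The algorithm is nondeterministic (choice of minimizers, order of the loops), so it is modelled
  by relations. The state of the inner loops is a pair \<open>(H, G)\<close>: \<open>H\<close> is the current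
  working set (X-hat) of the algorithm, \<open>G\<close> the set of all points generated so far (including those
  that have been discarded), from which the hyper-volume reference point is computed.
\<close>

primrec run_loop :: "('a \<Rightarrow> 's \<Rightarrow> 's \<Rightarrow> bool) \<Rightarrow> 'a list \<Rightarrow> 's \<Rightarrow> 's \<Rightarrow> bool" where
  "run_loop body [] s t \<longleftrightarrow> t = s"
| "run_loop body (x # xs) s t \<longleftrightarrow> (\<exists>s'. body x s s' \<and> run_loop body xs s' t)"

definition largest_step :: "real \<Rightarrow> real \<Rightarrow> (real \<Rightarrow> bool) \<Rightarrow> real \<Rightarrow> bool" where
  "largest_step \<alpha>0 \<delta> P \<alpha> \<longleftrightarrow>
     \<alpha> \<in> range (\<lambda>h::nat. \<alpha>0 * \<delta> ^ h) \<and> P \<alpha> \<and>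
     (\<forall>\<beta> \<in> range (\<lambda>h::nat. \<alpha>0 * \<delta> ^ h). P \<beta> \<longrightarrow> \<beta> \<le> \<alpha>)"

definition insert_point :: "('a \<Rightarrow> real^'m) \<Rightarrow> 'a \<Rightarrow> 'a set \<times> 'a set \<Rightarrow> 'a set \<times> 'a set" where
  "insert_point F z s = ((fst s \<union> {z}) - {y \<in> fst s. dominates F z y}, snd s \<union> {z})"

definition common_step ::
  "(real^'n \<Rightarrow> real^'m) \<Rightarrow> (real^'n) set \<Rightarrow> real \<Rightarrow> real \<Rightarrow> real \<Rightarrow> real
   \<Rightarrow> (real^'n) set \<Rightarrow> real^'n \<Rightarrow> real \<Rightarrow> bool" where
  "common_step F \<Omega> \<alpha>0 \<delta> \<gamma> \<sigma> H x \<alpha> \<longleftrightarrow>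
     (let v = v_dir F \<Omega> UNIV x in
      if theta F \<Omega> UNIV x < - \<sigma> then
        if \<exists>c\<in>H. F x \<le> F c then
          largest_step \<alpha>0 \<delta>
            (\<lambda>a. \<exists>c\<in>H. F x \<le> F c \<and> F (x + a *\<^sub>R v) \<le> F c + (\<gamma> * a * D_slope F x v) *\<^sub>R 1) \<alpha>
        else
          largest_step \<alpha>0 \<delta> (\<lambda>a. F (x + a *\<^sub>R v) \<le> F x + (\<gamma> * a * D_slope F x v) *\<^sub>R 1) \<alpha>
      else \<alpha> = 0)"

definition partial_step ::
  "(real^'n \<Rightarrow> real^'m) \<Rightarrow> (real^'n) set \<Rightarrow> real \<Rightarrow> real \<Rightarrow> real^'n \<Rightarrow> 'm set
   \<Rightarrow> (real^'n) set \<times> (real^'n) set \<Rightarrow> (real^'n) set \<times> (real^'n) set \<Rightarrow> bool" where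
  "partial_step F \<Omega> \<alpha>0 \<delta> z I s t \<longleftrightarrow>
     (let v = v_dir F \<Omega> I z in
      if z \<in> fst s then
        \<exists>\<alpha>. largest_step \<alpha>0 \<delta> (\<lambda>a. \<forall>y\<in>fst s. \<exists>j. F (z + a *\<^sub>R v) $ j < F y $ j) \<alpha> \<and>
            t = insert_point F (z + \<alpha> *\<^sub>R v) s
      else t = s)"

definition process_point ::
  "(real^'n \<Rightarrow> real^'m) \<Rightarrow> (real^'n) set \<Rightarrow> real \<Rightarrow> real \<Rightarrow> real \<Rightarrow> real \<Rightarrow> real^'n
   \<Rightarrow> (real^'n) set \<times> (real^'n) set \<Rightarrow> (real^'n) set \<times> (real^'n) set \<Rightarrow> bool" where
  "process_point F \<Omega> \<alpha>0 \<delta> \<gamma> \<sigma> x s t \<longleftrightarrow>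
     (if \<exists>y\<in>fst s. dominates F y x then t = s
      else \<exists>\<alpha> z Is.
        common_step F \<Omega> \<alpha>0 \<delta> \<gamma> \<sigma> (fst s) x \<alpha> \<and>
        z = x + \<alpha> *\<^sub>R v_dir F \<Omega> UNIV x \<and>
        distinct Is \<and> set Is = {I. I \<noteq> {} \<and> theta F \<Omega> I z < 0} \<and>
        run_loop (partial_step F \<Omega> \<alpha>0 \<delta> z) Is (insert_point F z s) t)"

text \<open>
  At iteration \<open>k\<close>, \<open>Xl k\<close> is the set of smallest hyper-volume selected at the start, \<open>Xhat k\<close> the
  working set after the loop, \<open>Xbl k\<close> the set of smallest hyper-volume selected after the loop,
  \<open>ord k\<close> lists \<open>X k\<close> in the order in which the loop processes it, and \<open>G k\<close> is the set of all
  points generated before iteration \<open>k\<close>. The existence of all step sizes is part of the assumption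
  that the algorithm produces the given sequences.
\<close>

definition FPD_NMT_run ::
  "(real^'n \<Rightarrow> real^'m) \<Rightarrow> (real^'n) set \<Rightarrow> real \<Rightarrow> real \<Rightarrow> real \<Rightarrow> (nat \<Rightarrow> real) \<Rightarrow> nat \<Rightarrow> (real^'n) set
   \<Rightarrow> (nat \<Rightarrow> (real^'n) set) \<Rightarrow> (nat \<Rightarrow> (real^'n) set) \<Rightarrow> (nat \<Rightarrow> (real^'n) set)
   \<Rightarrow> (nat \<Rightarrow> (real^'n) list) \<Rightarrow> (nat \<Rightarrow> (real^'n) set) \<Rightarrow> (nat \<Rightarrow> (real^'n) set)
   \<Rightarrow> (nat \<Rightarrow> (real^'n) set) \<Rightarrow> bool" where
  "FPD_NMT_run F \<Omega> \<alpha>0 \<delta> \<gamma> \<sigma> M X0 X Xl C ord Xhat Xbl G \<longleftrightarrow>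
     X 0 = X0 \<and> G 0 = X0 \<and>
     (\<forall>k.
        min_hypervolume F (G k) (X ` {k - min k M..k}) (Xl k) \<and>
        (let Cbar = nondominated F (Xl k \<union> (if k = 0 then {} else C (k - 1))) in
           C k = Cbar \<union> {x \<in> X k. \<forall>y\<in>Cbar. \<exists>j. F y $ j < F x $ j}) \<and>
        distinct (ord k) \<and> set (ord k) = X k \<and>
        run_loop (process_point F \<Omega> \<alpha>0 \<delta> \<gamma> (\<sigma> k)) (ord k) (C k, G k) (Xhat k, G (Suc k)) \<and>
        min_hypervolume F (G (Suc k)) ({Xhat k} \<union> X ` {k - min k (M - 1)..k}) (Xbl k) \<and>
        X (Suc k) = nondominated F (Xhat k \<union> Xbl k))"

end

theory Submission
  imports Defs
begin

text \<open>
  Every point of \<open>X k\<close> and \<open>C k\<close> lies in the compact level set, the first processed point \<open>x\<close> of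
  \<open>X k\<close> is never skipped, and some \<open>c\<close> in \<open>C k\<close> satisfies \<open>F x \<le> F c\<close>. If \<open>\<theta>\<close> at the first processed
  points stayed below \<open>- \<epsilon>\<close>, the step sizes would be bounded below, so each iteration would produce a
  point \<open>z k\<close> with \<open>F (z k) \<le> F (c k) - \<eta>\<close> for some \<open>c k\<close> in \<open>C k\<close> and a fixed \<open>\<eta> > 0\<close>. The region
  dominated by \<open>C k\<close> only grows, and among any \<open>M + 1\<close> consecutive new points at least one is
  eventually dominated by \<open>C k\<close>, because the selected set \<open>Xl k\<close> belongs to the last \<open>M + 1\<close>
  sets. As \<open>C k\<close> is mutually nondominated, this yields infinitely many values \<open>F (c k)\<close> at mutual
  distance at least \<open>\<eta>\<close> in a bounded set.
\<close>

section \<open>The direction-finding subproblem and its minimizer\<close>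

lemma max_slope_ge: "j \<in> I \<Longrightarrow> grad (\<lambda>y. F y $ j) x \<bullet> d \<le> max_slope F I x d"
  by (simp add: max_slope_def)

lemma max_slope_leI:
  "I \<noteq> {} \<Longrightarrow> (\<And>j. j \<in> I \<Longrightarrow> grad (\<lambda>y. F y $ j) x \<bullet> d \<le> c) \<Longrightarrow> max_slope F I x d \<le> c"
  by (simp add: max_slope_def)

lemma max_slope_zero: "I \<noteq> {} \<Longrightarrow> max_slope F I x 0 = 0"
  by (simp add: max_slope_def)

lemma max_slope_midpoint:
  assumes "I \<noteq> {}"
  shows "max_slope F I x ((1/2) *\<^sub>R (d + e)) \<le> (max_slope F I x d + max_slope F I x e) / 2"
proof (rule max_slope_leI[OF assms])
  fix j assume "j \<in> I"
  then have "grad (\<lambda>y. F y $ j) x \<bullet> d \<le> max_slope F I x d"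
    "grad (\<lambda>y. F y $ j) x \<bullet> e \<le> max_slope F I x e"
    by (auto intro: max_slope_ge)
  then show "grad (\<lambda>y. F y $ j) x \<bullet> ((1/2) *\<^sub>R (d + e)) \<le> (max_slope F I x d + max_slope F I x e) / 2"
    by (simp add: inner_add_right)
qed

lemma max_slope_lower_bound:
  assumes "I \<noteq> {}" and "\<And>j. j \<in> I \<Longrightarrow> norm (grad (\<lambda>y. F y $ j) x) \<le> B"
  shows "- (B * norm d) \<le> max_slope F I x d"
proof -
  obtain j where j: "j \<in> I" using assms(1) by blast
  have "\<bar>grad (\<lambda>y. F y $ j) x \<bullet> d\<bar> \<le> norm (grad (\<lambda>y. F y $ j) x) * norm d"
    by (rule Cauchy_Schwarz_ineq2)
  also have "\<dots> \<le> B * norm d" using assms(2)[OF j] by (simp add: mult_right_mono)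
  finally show ?thesis using max_slope_ge[OF j, of F x d] by linarith
qed

lemma continuous_on_Max:
  fixes g :: "'i \<Rightarrow> 'a::topological_space \<Rightarrow> real"
  assumes "finite I" "I \<noteq> {}" and "\<And>i. i \<in> I \<Longrightarrow> continuous_on S (g i)"
  shows "continuous_on S (\<lambda>x. Max ((\<lambda>i. g i x) ` I))"
  using assms by (induction I rule: finite_ne_induct) (auto intro: continuous_on_max)

lemma continuous_on_dir_objective: "I \<noteq> {} \<Longrightarrow> continuous_on S (dir_objective F I x)"
  unfolding dir_objective_def max_slope_def
  by (intro continuous_intros continuous_on_Max) auto

text \<open>Coercivity: if \<open>B\<close> bounds the gradients, the objective is at least
  \<open>norm d * (norm d / 2 - B)\<close>, hence nonnegative outside the ball of radius
  \<open>2 * B\<close>. Since \<open>d = 0\<close> is feasible with value 0, it suffices to minimize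
  over the compact part of the feasible set inside that ball.\<close>

lemma ex_arg_min_dir_objective:
  fixes F :: "real^'n \<Rightarrow> real^'m"
  assumes "closed \<Omega>" "x \<in> \<Omega>" "I \<noteq> {}"
  shows "\<exists>d. is_arg_min (dir_objective F I x) (\<lambda>d. x + d \<in> \<Omega>) d"
proof -
  define B where "B = (\<Sum>j\<in>UNIV. norm (grad (\<lambda>y. F y $ j) x))"
  have B: "norm (grad (\<lambda>y. F y $ j) x) \<le> B" for j
    unfolding B_def by (rule member_le_sum) auto
  have B0: "0 \<le> B" unfolding B_def by (simp add: sum_nonneg)
  let ?S = "{d. x + d \<in> \<Omega>} \<inter> cball 0 (2 * B)"
  have "closed {d. x + d \<in> \<Omega>}"
    using closed_vimage[OF assms(1), of "\<lambda>d. x + d"] by (simp add: vimage_def continuous_intros)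
  then have "compact ?S" by (rule closed_Int_compact) simp
  moreover have zero: "0 \<in> ?S" using assms(2) B0 by simp
  ultimately obtain d where d: "d \<in> ?S"
    and min: "\<And>e. e \<in> ?S \<Longrightarrow> dir_objective F I x d \<le> dir_objective F I x e"
    using continuous_attains_inf[OF _ _ continuous_on_dir_objective[OF assms(3)], of ?S F x] by blast
  have "dir_objective F I x d \<le> dir_objective F I x e" if "x + e \<in> \<Omega>" for e
  proof (cases "norm e \<le> 2 * B")
    case True
    then show ?thesis using that by (intro min) simp
  next
    case False
    have "dir_objective F I x d \<le> 0"
      using min[OF zero] by (simp add: dir_objective_def max_slope_zero[OF assms(3)])
    also have "0 \<le> norm e * (norm e / 2 - B)" using False by simp
    also have "\<dots> = - (B * norm e) + 1/2 * (norm e)\<^sup>2" by (simp add: power2_eq_square algebra_simps)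
    also have "\<dots> \<le> dir_objective F I x e"
      using max_slope_lower_bound[OF assms(3) B] by (simp add: dir_objective_def)
    finally show ?thesis .
  qed
  then show ?thesis using d unfolding is_arg_min_def by (metis IntD1 linorder_not_le mem_Collect_eq)
qed

text \<open>Strong convexity: the parallelogram identity for the quadratic term supplies the gain
  \<open>(norm (d - e))\<^sup>2 / 8\<close>.\<close>

lemma dir_objective_midpoint:
  assumes "I \<noteq> {}"
  shows "dir_objective F I x ((1/2) *\<^sub>R (d + e)) + (norm (d - e))\<^sup>2 / 8
    \<le> (dir_objective F I x d + dir_objective F I x e) / 2"
proof -
  have "(norm ((1/2) *\<^sub>R (d + e)))\<^sup>2 = ((norm d)\<^sup>2 + (norm e)\<^sup>2) / 2 - (norm (d - e))\<^sup>2 / 4"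
    by (simp add: power2_norm_eq_inner inner_add_left inner_add_right inner_diff_left
        inner_diff_right inner_commute field_simps)
  then show ?thesis
    using max_slope_midpoint[OF assms, of F x d e] by (simp add: dir_objective_def field_simps)
qed

text \<open>Gives meaning to the definite description in \<open>v_dir\<close>: two distinct
  minimizers would both be beaten by their midpoint, which is feasible by convexity.\<close>

lemma v_dir_is_arg_min:
  assumes "closed \<Omega>" "convex \<Omega>" "x \<in> \<Omega>" "I \<noteq> {}"
  shows "is_arg_min (dir_objective F I x) (\<lambda>d. x + d \<in> \<Omega>) (v_dir F \<Omega> I x)"
proof -
  let ?P = "is_arg_min (dir_objective F I x) (\<lambda>d. x + d \<in> \<Omega>)"
  have "d = e" if d: "?P d" and e: "?P e" for d e
  proof (rule ccontr)
    assume "d \<noteq> e"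
    then have pos: "0 < (norm (d - e))\<^sup>2 / 8" by simp
    have eq: "dir_objective F I x d = dir_objective F I x e"
      using d e unfolding is_arg_min_def by (meson linorder_neqE)
    have "dir_objective F I x ((1/2) *\<^sub>R (d + e)) + (norm (d - e))\<^sup>2 / 8 \<le> dir_objective F I x d"
      using dir_objective_midpoint[OF assms(4), of F x d e] unfolding eq by simp
    with pos have "dir_objective F I x ((1/2) *\<^sub>R (d + e)) < dir_objective F I x d"
      by (rule less_le_trans[OF less_add_same_cancel1[THEN iffD2]])
    moreover have "x + (1/2) *\<^sub>R (d + e) \<in> \<Omega>"
    proof -
      have "(1/2) *\<^sub>R (x + d) + (1/2) *\<^sub>R (x + e) \<in> \<Omega>"
        using d e by (intro convexD[OF assms(2)]) (auto simp: is_arg_min_def)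
      moreover have "(1/2) *\<^sub>R (x + d) + (1/2) *\<^sub>R (x + e) = x + (1/2) *\<^sub>R (d + e)"
        by (simp add: algebra_simps flip: scaleR_add_left)
      ultimately show ?thesis by simp
    qed
    ultimately show False using d by (auto simp: is_arg_min_def)
  qed
  then show ?thesis
    unfolding v_dir_def using ex_arg_min_dir_objective[OF assms(1,3,4)] by (metis (mono_tags, lifting) theI)
qed

lemma theta_eq_dir_objective:
  assumes "closed \<Omega>" "convex \<Omega>" "x \<in> \<Omega>" "I \<noteq> {}"
  shows "theta F \<Omega> I x = dir_objective F I x (v_dir F \<Omega> I x)"
  unfolding theta_def using v_dir_is_arg_min[OF assms, of F]
  by (intro cInf_eq_minimum) (auto simp: is_arg_min_def not_less)

lemma theta_nonpos:
  assumes "closed \<Omega>" "convex \<Omega>" "x \<in> \<Omega>" "I \<noteq> {}"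
  shows "theta F \<Omega> I x \<le> 0"
proof -
  have "dir_objective F I x (v_dir F \<Omega> I x) \<le> dir_objective F I x 0"
    using v_dir_is_arg_min[OF assms, of F] assms(3)
    unfolding is_arg_min_def by (metis add_0_right not_less)
  then show ?thesis
    by (simp add: theta_eq_dir_objective[OF assms] dir_objective_def max_slope_zero[OF assms(4)])
qed

lemma step_along_v_dir_in:
  assumes "closed \<Omega>" "convex \<Omega>" "x \<in> \<Omega>" "I \<noteq> {}" "0 \<le> a" "a \<le> 1"
  shows "x + a *\<^sub>R v_dir F \<Omega> I x \<in> \<Omega>"
proof -
  have "x + v_dir F \<Omega> I x \<in> \<Omega>"
    using v_dir_is_arg_min[OF assms(1-4), of F] by (simp add: is_arg_min_def)
  then have "(1 - a) *\<^sub>R x + a *\<^sub>R (x + v_dir F \<Omega> I x) \<in> \<Omega>"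
    using assms by (intro convexD) auto
  moreover have "(1 - a) *\<^sub>R x + a *\<^sub>R (x + v_dir F \<Omega> I x) = x + a *\<^sub>R v_dir F \<Omega> I x"
    by (simp add: algebra_simps)
  ultimately show ?thesis by simp
qed

section \<open>Gradients and uniform sufficient decrease\<close>

text \<open>\<open>grad\<close> is a definite description, so a gradient has to be exhibited and
  shown unique. Its coordinates are the values of the component derivative on the basis
  vectors.\<close>

lemma inner_grad_component:
  fixes F :: "real^'n \<Rightarrow> real^'m"
  assumes "(F has_derivative F') (at x)"
  shows "grad (\<lambda>y. F y $ j) x \<bullet> d = F' d $ j"
proof -
  have der: "((\<lambda>y. F y $ j) has_derivative (\<lambda>h. F' h $ j)) (at x)"
    using assms by (rule bounded_linear.has_derivative[OF bounded_linear_vec_nth])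
  define g where "g = (\<Sum>b\<in>Basis. (F' b $ j) *\<^sub>R b)"
  have rep: "F' h $ j = h \<bullet> g" for h
  proof -
    have lin: "linear (\<lambda>h. F' h $ j)"
      using has_derivative_linear[OF der] .
    have "F' h $ j = (\<Sum>b\<in>Basis. (h \<bullet> b) *\<^sub>R (F' b $ j))"
      using linear_sum[OF lin, of "\<lambda>b. (h \<bullet> b) *\<^sub>R b" Basis]
      by (simp only: euclidean_representation linear_scale[OF lin])
    then show ?thesis by (simp add: g_def inner_sum_right mult.commute)
  qed
  have G: "GDERIV (\<lambda>y. F y $ j) x :> g"
    using der unfolding gderiv_def rep .
  have "grad (\<lambda>y. F y $ j) x = g"
    unfolding grad_def
  proof (rule the_equality[where a = g])
    show "GDERIV (\<lambda>y. F y $ j) x :> g" by (fact G)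
  next
    fix g' assume "GDERIV (\<lambda>y. F y $ j) x :> g'"
    then have "(\<lambda>h. h \<bullet> g') = (\<lambda>h. h \<bullet> g)"
      using G unfolding gderiv_def by (rule has_derivative_unique)
    then have "h \<bullet> g' = h \<bullet> g" for h by (rule fun_cong)
    then show "g' = g" using vector_eq_ldot by blast
  qed
  then show ?thesis by (simp add: rep inner_commute)
qed

text \<open>On a compact set the directions are bounded and the derivative is uniformly continuous
  near all trial segments, so a single threshold \<open>amin\<close> works for every
  \<open>x\<close> at which \<open>theta\<close> is bounded away from 0.\<close>

lemma sufficient_decrease:
  fixes F :: "real^'n \<Rightarrow> real^'m"
  assumes F: "continuously_differentiable F"
    and \<Omega>: "closed \<Omega>" "convex \<Omega>"
    and L: "compact L" "L \<subseteq> \<Omega>"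
    and \<epsilon>: "0 < \<epsilon>" and \<gamma>: "\<gamma> < 1"
  shows "\<exists>amin>0. \<forall>x\<in>L. \<forall>a. theta F \<Omega> UNIV x \<le> - \<epsilon> \<longrightarrow> 0 < a \<longrightarrow> a \<le> amin \<longrightarrow>
     F (x + a *\<^sub>R v_dir F \<Omega> UNIV x)
       \<le> F x + (\<gamma> * a * D_slope F x (v_dir F \<Omega> UNIV x)) *\<^sub>R 1"
proof -
  obtain F' :: "real^'n \<Rightarrow> (real^'n) \<Rightarrow>\<^sub>L (real^'m)"
    where F': "\<And>x. (F has_derivative blinfun_apply (F' x)) (at x)"
      and cont: "continuous_on UNIV F'"
    using F unfolding continuously_differentiable_def by blast
  have slope: "D_slope F x d = Max ((\<lambda>j. F' x d $ j) ` UNIV)" for x d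
    unfolding max_slope_def by (simp add: inner_grad_component[OF F'])
  have "bounded (F' ` L)"
    using L(1) cont by (meson compact_continuous_image compact_imp_bounded continuous_on_subset subset_UNIV)
  then obtain B where B: "0 < B" "\<And>x. x \<in> L \<Longrightarrow> norm (F' x) \<le> B"
    by (force simp: bounded_pos)
  obtain r where r: "\<And>x. x \<in> L \<Longrightarrow> norm x \<le> r"
    using compact_imp_bounded[OF L(1)] unfolding bounded_iff by blast
  \<comment> \<open>The radius leaves room for a displacement of length \<open>2 * B\<close> from
    any point of \<open>L\<close>; directions turn out to be no longer than that.\<close>
  have "uniformly_continuous_on (cball 0 (r + 2 * B)) F'"
    using cont by (intro compact_uniformly_continuous) (auto intro: continuous_on_subset)
  \<comment> \<open>Chosen so that the linearization error \<open>a * (2 * B) * w\<close> equals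
    \<open>a * ((1 - \<gamma>) * \<epsilon>)\<close>.\<close>
  moreover define w where "w = (1 - \<gamma>) * \<epsilon> / (2 * B)"
  moreover have "0 < w" using \<epsilon> \<gamma> B(1) by (simp add: w_def)
  ultimately obtain \<rho> where \<rho>: "0 < \<rho>"
    "\<And>x y. x \<in> cball 0 (r + 2 * B) \<Longrightarrow> y \<in> cball 0 (r + 2 * B) \<Longrightarrow> dist y x < \<rho> \<Longrightarrow> dist (F' y) (F' x) < w"
    unfolding uniformly_continuous_on_def by metis
  \<comment> \<open>The bound 1 keeps the segment in the ball; the other bound keeps displacements
    at most \<open>\<rho> / 2\<close>.\<close>
  define amin where "amin = min 1 (\<rho> / (4 * B))"
  have "0 < amin" using \<rho>(1) B(1) by (simp add: amin_def)
  moreover have "F (x + a *\<^sub>R v_dir F \<Omega> UNIV x)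
       \<le> F x + (\<gamma> * a * D_slope F x (v_dir F \<Omega> UNIV x)) *\<^sub>R 1"
    if x: "x \<in> L" and th: "theta F \<Omega> UNIV x \<le> - \<epsilon>" and a: "0 < a" "a \<le> amin" for x a
  proof -
    define v where "v = v_dir F \<Omega> UNIV x"
    define D where "D = D_slope F x v"
    have D_eq: "theta F \<Omega> UNIV x = D + 1/2 * (norm v)\<^sup>2"
      using theta_eq_dir_objective[OF \<Omega>, of x UNIV F] x L(2)
      by (auto simp: dir_objective_def D_def v_def)
    have D_le: "D \<le> - \<epsilon>" using D_eq th zero_le_power2[of "norm v"] by linarith
    have comp: "F' x v $ j \<le> D" for j by (simp add: D_def slope)
    have v_le: "norm v \<le> 2 * B"
    proof -
      obtain j :: 'm where True by blast
      have "\<bar>F' x v $ j\<bar> \<le> norm (F' x v)" by (rule component_le_norm_cart)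
      also have "\<dots> \<le> norm (F' x) * norm v" by (rule norm_blinfun)
      also have "\<dots> \<le> B * norm v" using B(2)[OF x] by (simp add: mult_right_mono)
      finally have "- (B * norm v) \<le> D" using comp[of j] by linarith
      \<comment> \<open>A negative \<open>theta\<close> bounds the quadratic term by
        \<open>- D\<close>.\<close>
      then have "1/2 * (norm v)\<^sup>2 \<le> B * norm v" using D_eq th \<epsilon> by linarith
      then have "norm v * norm v \<le> (2 * B) * norm v" by (simp add: power2_eq_square)
      then show ?thesis using B(1)
        by (metis mult_right_le_imp_le norm_ge_zero less_eq_real_def mult_pos_pos zero_less_numeral)
    qed
    have near: "y \<in> cball 0 (r + 2 * B) \<and> dist y x < \<rho>" if "y \<in> closed_segment x (x + a *\<^sub>R v)" for y
    proof -
      obtain t where t: "0 \<le> t" "t \<le> 1" "y = x + (t * a) *\<^sub>R v"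
        using \<open>y \<in> _\<close> by (auto simp: in_segment algebra_simps)
      have ta: "t * a \<le> amin" "0 \<le> t * a"
        using t a by (auto intro: order_trans[OF mult_left_le_one_le])
      then have n: "norm (y - x) \<le> amin * (2 * B)"
        using v_le t by (auto intro!: mult_mono)
      also have "\<dots> \<le> \<rho> / (4 * B) * (2 * B)"
        using B(1) by (intro mult_right_mono) (auto simp: amin_def)
      also have "\<dots> < \<rho>" using B(1) \<rho>(1) by simp
      finally have "dist y x < \<rho>" by (simp add: dist_norm)
      moreover have "amin * (2 * B) \<le> 2 * B" using B(1) by (simp add: amin_def)
      then have "norm y \<le> r + 2 * B"
        using n r[OF x] norm_triangle_ineq[of x "y - x"] by simp
      ultimately show ?thesis by simp
    qed
    have xin: "x \<in> cball 0 (r + 2 * B)" using near[of x] by simp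
    have "norm (F (x + a *\<^sub>R v) - F x - F' x ((x + a *\<^sub>R v) - x)) \<le> norm ((x + a *\<^sub>R v) - x) * w"
    proof (rule differentiable_bound_linearization[where S = "closed_segment x (x + a *\<^sub>R v)"
          and f' = "\<lambda>y. blinfun_apply (F' y)"])
      show "x + t *\<^sub>R (x + a *\<^sub>R v - x) \<in> closed_segment x (x + a *\<^sub>R v)" if "t \<in> {0..1}" for t
        using that by (auto simp: in_segment algebra_simps intro!: exI[of _ t])
      show "(F has_derivative F' y) (at y within closed_segment x (x + a *\<^sub>R v))" for y
        using F' by (rule has_derivative_at_withinI)
      show "onorm (blinfun_apply (F' y) - blinfun_apply (F' x)) \<le> w" if y: "y \<in> closed_segment x (x + a *\<^sub>R v)" for y
      proof -
        have "norm (F' y - F' x) < w"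
          using \<rho>(2)[OF xin] near[OF y] by (auto simp: dist_norm)
        then show ?thesis by (simp add: norm_blinfun.rep_eq minus_blinfun.rep_eq fun_diff_def)
      qed
    qed simp
    also have "\<dots> \<le> (a * (2 * B)) * w"
      using v_le a(1) \<open>0 < w\<close> by (intro mult_right_mono) auto
    also have "\<dots> = a * ((1 - \<gamma>) * \<epsilon>)" using B(1) by (simp add: w_def)
    finally have err: "norm (F (x + a *\<^sub>R v) - F x - a *\<^sub>R F' x v) \<le> a * ((1 - \<gamma>) * \<epsilon>)"
      by (simp add: blinfun.scaleR_right)
    have "F (x + a *\<^sub>R v) $ j \<le> F x $ j + \<gamma> * a * D" for j
    proof -
      have "(F (x + a *\<^sub>R v) - F x - a *\<^sub>R F' x v) $ j \<le> a * ((1 - \<gamma>) * \<epsilon>)"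
        using err component_le_norm_cart[of "F (x + a *\<^sub>R v) - F x - a *\<^sub>R F' x v" j] by linarith
      \<comment> \<open>Since \<open>- D\<close> is at least \<open>\<epsilon>\<close>, the error is
        absorbed by the slope: \<open>a * D\<close> plus \<open>a * ((1 - \<gamma>) * - D)\<close>
        is \<open>\<gamma> * a * D\<close>.\<close>
      also have "\<dots> \<le> a * ((1 - \<gamma>) * - D)"
        using a(1) \<gamma> D_le by (intro mult_left_mono) auto
      finally have "F (x + a *\<^sub>R v) $ j \<le> F x $ j + a * F' x v $ j + a * ((1 - \<gamma>) * - D)" by simp
      moreover have "a * F' x v $ j \<le> a * D" using comp a(1) by (intro mult_left_mono) auto
      ultimately show ?thesis by (simp add: algebra_simps)
    qed
    then show ?thesis by (simp add: less_eq_vec_def v_def D_def)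
  qed
  ultimately show ?thesis by blast
qed

section \<open>The covering relation, backtracking and the inner loops\<close>

text \<open>This is inclusion of the upper sets generated by the values on \<open>B\<close> and on
  \<open>A\<close>. Unlike membership, it persists when a point is replaced by one that dominates
  it.\<close>

definition covers :: "('a \<Rightarrow> real^'m) \<Rightarrow> 'a set \<Rightarrow> 'a set \<Rightarrow> bool" where
  "covers F A B \<longleftrightarrow> (\<forall>b\<in>B. \<exists>a\<in>A. F a \<le> F b)"

lemma covers_superset: "B \<subseteq> A \<Longrightarrow> covers F A B"
  unfolding covers_def by blast

lemma covers_trans: "covers F A B \<Longrightarrow> covers F B C \<Longrightarrow> covers F A C"
  unfolding covers_def by (meson order_trans)

lemma covers_nondominated:
  assumes "finite A"
  shows "covers F (nondominated F A) A"
  unfolding covers_def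
proof
  fix b assume "b \<in> A"
  then obtain a where "a \<in> A" "F a \<le> F b" "\<forall>c\<in>A. F c \<le> F a \<longrightarrow> F c = F a"
    using finite_has_minimal2[of "F ` A" "F b"] assms by fastforce
  then show "\<exists>a\<in>nondominated F A. F a \<le> F b"
    unfolding nondominated_def dominates_def by blast
qed

text \<open>A dominating \<open>b\<close> is covered by some \<open>a\<close> with
  \<open>F a \<le> F b\<close>; if \<open>F a = F x\<close>, then \<open>F b\<close> would be
  squeezed to \<open>F x\<close>, so \<open>a\<close> dominates \<open>x\<close> as well.\<close>

lemma not_dominated_by_covered:
  assumes "covers F A B" "\<not> (\<exists>a\<in>A. dominates F a x)"
  shows "\<not> (\<exists>b\<in>B. dominates F b x)"
  using assms unfolding covers_def dominates_def by (metis order_antisym order_trans)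

lemma covers_insert_point: "covers F (fst (insert_point F z s)) (insert z (fst s))"
  unfolding covers_def insert_point_def dominates_def by auto

lemma run_loop_invariant:
  assumes "run_loop body xs s t" "P s"
    and "\<And>x s s'. x \<in> set xs \<Longrightarrow> body x s s' \<Longrightarrow> P s \<Longrightarrow> P s'"
  shows "P t"
  using assms
proof (induction xs arbitrary: s)
  case (Cons x xs)
  then obtain s' where "body x s s'" "run_loop body xs s' t" by auto
  then show ?case using Cons.prems Cons.IH[of s'] by (metis list.set_intros)
qed simp

lemma largest_step_range:
  assumes "largest_step \<alpha>0 \<delta> P \<alpha>" "0 < \<alpha>0" "\<alpha>0 \<le> 1" "0 < \<delta>" "\<delta> < 1"
  shows "0 < \<alpha>" "\<alpha> \<le> 1"
proof -
  obtain h :: nat where h: "\<alpha> = \<alpha>0 * \<delta> ^ h" using assms(1) by (auto simp: largest_step_def)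
  show "0 < \<alpha>" using assms h by simp
  have "\<delta> ^ h \<le> 1" using assms by (simp add: power_le_one)
  then show "\<alpha> \<le> 1" using assms h by (simp add: mult_le_one)
qed

text \<open>Either the first trial step \<open>\<alpha>0\<close> is accepted, or the preceding trial
  \<open>\<alpha> / \<delta>\<close> failed and therefore exceeds \<open>amin\<close>.\<close>

lemma largest_step_lower_bound:
  assumes "largest_step \<alpha>0 \<delta> P \<alpha>" "0 < \<alpha>0" "0 < \<delta>" "\<delta> < 1"
    and P: "\<And>a. 0 < a \<Longrightarrow> a \<le> amin \<Longrightarrow> P a"
  shows "min \<alpha>0 (\<delta> * amin) \<le> \<alpha>"
proof -
  obtain h :: nat where h: "\<alpha> = \<alpha>0 * \<delta> ^ h" using assms(1) by (auto simp: largest_step_def)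
  show ?thesis
  proof (cases h)
    case (Suc i)
    have "\<alpha>0 * \<delta> ^ i > \<alpha>" using assms Suc h by simp
    then have "\<not> P (\<alpha>0 * \<delta> ^ i)" using assms(1) by (fastforce simp: largest_step_def)
    then have "amin < \<alpha>0 * \<delta> ^ i" using P[of "\<alpha>0 * \<delta> ^ i"] assms(2,3) by force
    then have "\<delta> * amin < \<alpha>" using assms(3) h Suc by simp
    then show ?thesis by simp
  qed (simp add: h)
qed

text \<open>Step sizes lie between 0 and 1, so convexity keeps every new point in
  \<open>\<Omega>\<close>. Each deletion is caused by a point dominating the deleted one, so
  coverage is not lost.\<close>

lemma process_point_invariant:
  assumes \<Omega>: "closed \<Omega>" "convex \<Omega>" and par: "0 < \<alpha>0" "\<alpha>0 \<le> 1" "0 < \<delta>" "\<delta> < 1"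
    and x: "x \<in> \<Omega>"
    and step: "process_point F \<Omega> \<alpha>0 \<delta> \<gamma> \<sigma> x s t"
    and s: "finite (fst s)" "fst s \<subseteq> \<Omega>"
  shows "finite (fst t) \<and> fst t \<subseteq> \<Omega> \<and> covers F (fst t) (fst s)"
proof (cases "\<exists>y\<in>fst s. dominates F y x")
  case True
  then show ?thesis using step s by (simp add: process_point_def covers_superset)
next
  case False
  then obtain \<alpha> z Is where c: "common_step F \<Omega> \<alpha>0 \<delta> \<gamma> \<sigma> (fst s) x \<alpha>"
    and z: "z = x + \<alpha> *\<^sub>R v_dir F \<Omega> UNIV x"
    and Is: "set Is = {I. I \<noteq> {} \<and> theta F \<Omega> I z < 0}"
    and loop: "run_loop (partial_step F \<Omega> \<alpha>0 \<delta> z) Is (insert_point F z s) t"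
    using step by (auto simp: process_point_def)
  have "0 \<le> \<alpha> \<and> \<alpha> \<le> 1"
    using c largest_step_range[OF _ par] unfolding common_step_def Let_def
    by (auto split: if_splits simp: less_imp_le)
  then have zin: "z \<in> \<Omega>" unfolding z by (intro step_along_v_dir_in[OF \<Omega> x]) auto
  let ?P = "\<lambda>t. finite (fst t) \<and> fst t \<subseteq> \<Omega> \<and> covers F (fst t) (fst s)"
  have ins: "?P (insert_point F w t)" if "w \<in> \<Omega>" "?P t" for w t
  proof -
    have "covers F (fst (insert_point F w t)) (fst t)"
      using covers_insert_point[of F w t] by (simp add: covers_def)
    then have "covers F (fst (insert_point F w t)) (fst s)"
      by (rule covers_trans) (use that in simp)
    then show ?thesis using that by (auto simp: insert_point_def)
  qed
  show ?thesis
  proof (rule run_loop_invariant[where P = ?P, OF loop])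
    show "?P (insert_point F z s)" using ins[OF zin] s by (simp add: covers_superset)
    show "?P t'" if I: "I \<in> set Is" and b: "partial_step F \<Omega> \<alpha>0 \<delta> z I s' t'" and P: "?P s'" for I s' t'
    proof (cases "z \<in> fst s'")
      case True
      then obtain \<alpha>' where \<alpha>': "largest_step \<alpha>0 \<delta>
            (\<lambda>a. \<forall>y\<in>fst s'. \<exists>j. F (z + a *\<^sub>R v_dir F \<Omega> I z) $ j < F y $ j) \<alpha>'"
        and t': "t' = insert_point F (z + \<alpha>' *\<^sub>R v_dir F \<Omega> I z) s'"
        using b by (auto simp: partial_step_def Let_def)
      have "z + \<alpha>' *\<^sub>R v_dir F \<Omega> I z \<in> \<Omega>"
        using largest_step_range[OF \<alpha>' par] zin I Is by (intro step_along_v_dir_in[OF \<Omega>]) auto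
      then show ?thesis using ins[OF _ P] t' by blast
    qed (use b P in \<open>simp add: partial_step_def\<close>)
  qed
qed

text \<open>The new point may be deleted during the partial descent steps, but only in favour of a
  point dominating it; hence the invariant is coverage and not membership.\<close>

lemma process_point_covers_new_point:
  assumes step: "process_point F \<Omega> \<alpha>0 \<delta> \<gamma> \<sigma> x s t"
    and nd: "\<not> (\<exists>y\<in>fst s. dominates F y x)"
  shows "\<exists>\<alpha>. common_step F \<Omega> \<alpha>0 \<delta> \<gamma> \<sigma> (fst s) x \<alpha> \<and> covers F (fst t) {x + \<alpha> *\<^sub>R v_dir F \<Omega> UNIV x}"
proof -
  obtain \<alpha> z Is where c: "common_step F \<Omega> \<alpha>0 \<delta> \<gamma> \<sigma> (fst s) x \<alpha>"
    and z: "z = x + \<alpha> *\<^sub>R v_dir F \<Omega> UNIV x"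
    and loop: "run_loop (partial_step F \<Omega> \<alpha>0 \<delta> z) Is (insert_point F z s) t"
    using step nd by (auto simp: process_point_def)
  have "covers F (fst t) {z}"
  proof (rule run_loop_invariant[where P = "\<lambda>t. covers F (fst t) {z}", OF loop])
    show "covers F (fst (insert_point F z s)) {z}"
      by (rule covers_superset) (auto simp: insert_point_def dominates_def)
    show "covers F (fst t') {z}" if b: "partial_step F \<Omega> \<alpha>0 \<delta> z I s' t'" and P: "covers F (fst s') {z}" for I s' t'
    proof -
      have "covers F (insert w (fst s')) {z}" for w using P by (auto simp: covers_def)
      then have ins: "covers F (fst (insert_point F w s')) {z}" for w
        by (rule covers_trans[OF covers_insert_point])
      show ?thesis
        using b P ins unfolding partial_step_def Let_def by (metis (no_types, lifting))
    qed
  qed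
  then show ?thesis using c z by blast
qed

section \<open>Invariants of the sets produced by the algorithm\<close>

text \<open>The assumption on the worst sets is shifted by one index, so that
  \<open>Xl (Suc k)\<close> is the set merged with \<open>Xhat k\<close> to form
  \<open>X (Suc k)\<close>.\<close>

locale FPD_NMT =
  fixes F :: "real^'n \<Rightarrow> real^'m"
    and \<Omega> :: "(real^'n) set"
    and \<alpha>0 \<delta> \<gamma> :: real and \<sigma> :: "nat \<Rightarrow> real" and M :: nat
    and X0 :: "(real^'n) set"
    and X Xl C Xhat Xbl G :: "nat \<Rightarrow> (real^'n) set" and ord :: "nat \<Rightarrow> (real^'n) list"
  assumes \<Omega>: "closed \<Omega>" "convex \<Omega>"
    and params: "0 < \<alpha>0" "\<alpha>0 \<le> 1" "0 < \<delta>" "\<delta> < 1" "0 < \<gamma>" "\<gamma> < 1"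
    and X0: "X0 \<subseteq> \<Omega>" "mutually_nondominated F X0"
    and run: "FPD_NMT_run F \<Omega> \<alpha>0 \<delta> \<gamma> \<sigma> M X0 X Xl C ord Xhat Xbl G"
    and same_worst_set: "\<And>k. Xbl k = Xl (Suc k)"
begin

text \<open>Encodes the convention that \<open>C\<close> is empty before iteration 0.\<close>

definition prevC :: "nat \<Rightarrow> (real^'n) set" where
  "prevC k = (if k = 0 then {} else C (k - 1))"

definition Cbar :: "nat \<Rightarrow> (real^'n) set" where
  "Cbar k = nondominated F (Xl k \<union> prevC k)"

lemma X_0: "X 0 = X0"
  using run by (simp add: FPD_NMT_run_def)

lemma Xl_window: "Xl k \<in> X ` {k - min k M..k}"
  and C_eq: "C k = Cbar k \<union> {x \<in> X k. \<forall>y\<in>Cbar k. \<exists>j. F y $ j < F x $ j}"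
  and set_ord: "set (ord k) = X k"
  and loop: "run_loop (process_point F \<Omega> \<alpha>0 \<delta> \<gamma> (\<sigma> k)) (ord k) (C k, G k) (Xhat k, G (Suc k))"
  and Xbl_cases: "Xbl k \<in> {Xhat k} \<union> X ` {k - min k (M - 1)..k}"
  and X_Suc: "X (Suc k) = nondominated F (Xhat k \<union> Xl (Suc k))"
proof -
  have iter: "min_hypervolume F (G k) (X ` {k - min k M..k}) (Xl k) \<and>
      C k = Cbar k \<union> {x \<in> X k. \<forall>y\<in>Cbar k. \<exists>j. F y $ j < F x $ j} \<and>
      distinct (ord k) \<and> set (ord k) = X k \<and>
      run_loop (process_point F \<Omega> \<alpha>0 \<delta> \<gamma> (\<sigma> k)) (ord k) (C k, G k) (Xhat k, G (Suc k)) \<and>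
      min_hypervolume F (G (Suc k)) ({Xhat k} \<union> X ` {k - min k (M - 1)..k}) (Xbl k) \<and>
      X (Suc k) = nondominated F (Xhat k \<union> Xbl k)"
    using run unfolding FPD_NMT_run_def Let_def Cbar_def prevC_def by blast
  then show "Xl k \<in> X ` {k - min k M..k}"
    and "Xbl k \<in> {Xhat k} \<union> X ` {k - min k (M - 1)..k}"
    unfolding min_hypervolume_def is_arg_min_def by blast+
  from iter show "X (Suc k) = nondominated F (Xhat k \<union> Xl (Suc k))"
    unfolding same_worst_set by blast
  from iter show "C k = Cbar k \<union> {x \<in> X k. \<forall>y\<in>Cbar k. \<exists>j. F y $ j < F x $ j}"
    and "set (ord k) = X k"
    and "run_loop (process_point F \<Omega> \<alpha>0 \<delta> \<gamma> (\<sigma> k)) (ord k) (C k, G k) (Xhat k, G (Suc k))"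
    by blast+
qed

lemma finite_X: "finite (X k)"
  using set_ord[of k] by (metis finite_set)

lemma finite_Xl: "finite (Xl k)"
  using Xl_window[of k] finite_X by auto

lemma Cbar_subset: "Cbar k \<subseteq> Xl k \<union> prevC k"
  by (auto simp: Cbar_def nondominated_def)

lemma C_subset: "C k \<subseteq> Xl k \<union> prevC k \<union> X k"
  using C_eq Cbar_subset by blast

text \<open>The premises remain explicit because the induction in \<open>points_in_box\<close>,
  which establishes them, calls this lemma.\<close>

lemma Xhat_invariant_step:
  assumes "X k \<subseteq> \<Omega>" "finite (C k)" "C k \<subseteq> \<Omega>"
  shows "finite (Xhat k) \<and> Xhat k \<subseteq> \<Omega> \<and> covers F (Xhat k) (C k)"
proof -
  let ?P = "\<lambda>t. finite (fst t) \<and> fst t \<subseteq> \<Omega> \<and> covers F (fst t) (C k)"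
  have "?P (Xhat k, G (Suc k))"
  proof (rule run_loop_invariant[where P = ?P, OF loop])
    show "?P (C k, G k)" using assms by (simp add: covers_superset)
    show "?P s'" if "x \<in> set (ord k)" "process_point F \<Omega> \<alpha>0 \<delta> \<gamma> (\<sigma> k) x s s'" "?P s" for x s s'
      using process_point_invariant[OF \<Omega> params(1-4) _ that(2)] that assms(1) set_ord[of k] covers_trans
      by blast
  qed
  then show ?thesis by simp
qed

text \<open>The induction carries all earlier sets because \<open>Xl k\<close> may be any of those
  in the window. With \<open>prevC\<close>, the facts about \<open>C k\<close> become part of the
  claim at \<open>Suc k\<close>.\<close>

lemma points_in_box: "(\<forall>i\<le>k. X i \<subseteq> \<Omega>) \<and> finite (prevC k) \<and> prevC k \<subseteq> \<Omega>"
proof (induction k)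
  case 0
  then show ?case using X0 by (simp add: X_0 prevC_def)
next
  case (Suc k)
  have old: "X i \<subseteq> \<Omega>" if "i \<le> k" for i using Suc that by blast
  have Xl: "Xl k \<subseteq> \<Omega>" using Xl_window[of k] old by (metis atLeastAtMost_iff imageE)
  have C: "finite (C k)" "C k \<subseteq> \<Omega>"
    using finite_subset[OF C_subset[of k]] finite_X[of k] finite_Xl[of k] C_subset[of k] Xl Suc old[of k]
    by (simp_all, blast)
  then have Xhat: "Xhat k \<subseteq> \<Omega>" using Xhat_invariant_step old by blast
  moreover have "Xl (Suc k) \<subseteq> \<Omega>"
    using Xbl_cases[of k] Xhat old unfolding same_worst_set
    by (metis UnE atLeastAtMost_iff imageE singletonD)
  ultimately have "X (Suc k) \<subseteq> \<Omega>" unfolding X_Suc nondominated_def by blast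
  then have "X i \<subseteq> \<Omega>" if "i \<le> Suc k" for i
    using that old[of i] by (cases "i = Suc k") auto
  then show ?case using C by (simp add: prevC_def)
qed

lemma X_in_box: "X k \<subseteq> \<Omega>"
  using points_in_box[of k] by simp

lemma C_in_box: "C k \<subseteq> \<Omega>" and finite_C: "finite (C k)"
  using points_in_box[of "Suc k"] by (simp_all add: prevC_def)

lemma finite_Xhat: "finite (Xhat k)" and Xhat_covers_C: "covers F (Xhat k) (C k)"
  using Xhat_invariant_step[OF X_in_box finite_C C_in_box] by auto

lemma Cbar_covers: "covers F (Cbar k) (Xl k \<union> prevC k)"
  unfolding Cbar_def using finite_Xl[of k] points_in_box[of k] by (intro covers_nondominated) simp

lemma C_covers: "covers F (C k) (Xl k \<union> prevC k)"
  using Cbar_covers[of k] unfolding C_eq[of k] covers_def by blast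

text \<open>Each \<open>C k\<close> re-enters the pool filtered into \<open>Cbar (Suc k)\<close>, so
  the covered region never shrinks.\<close>

lemma C_mono: "i \<le> k \<Longrightarrow> covers F (C k) (C i)"
proof (induction k rule: dec_induct)
  case base
  show ?case by (simp add: covers_superset)
next
  case (step k)
  have "covers F (C (Suc k)) (C k)"
    using C_covers[of "Suc k"] by (simp add: prevC_def covers_def)
  then show ?case using step.IH by (rule covers_trans)
qed

lemma X_covers_Xhat: "covers F (X (Suc k)) (Xhat k)"
  using covers_nondominated[of "Xhat k \<union> Xl (Suc k)" F] finite_Xhat finite_Xl
  by (simp add: X_Suc covers_def)

lemma X_nondominated: "mutually_nondominated F (X k)"
  using X0(2) by (cases k) (auto simp: X_0 X_Suc mutually_nondominated_def nondominated_def)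

text \<open>The equality of the worst sets acts here: \<open>X (Suc i)\<close> was filtered against
  \<open>Xl (Suc i)\<close>, and against \<open>Xhat i\<close>, which covers \<open>C i\<close>. At
  index 0 the window contains only \<open>X 0\<close>.\<close>

lemma X_not_dominated:
  assumes "x \<in> X k"
  shows "\<not> (\<exists>y\<in>Xl k \<union> prevC k. dominates F y x)"
proof (cases k)
  case 0
  then show ?thesis
    using assms X_nondominated[of 0] Xl_window[of 0] by (auto simp: prevC_def mutually_nondominated_def)
next
  case (Suc i)
  have nd: "\<not> (\<exists>y\<in>Xhat i \<union> Xl k. dominates F y x)"
    using assms by (auto simp: Suc X_Suc nondominated_def)
  moreover have "covers F (Xhat i \<union> Xl k) (Xl k \<union> prevC k)"
    using Xhat_covers_C[of i] by (auto simp: Suc prevC_def covers_def)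
  ultimately show ?thesis by (metis not_dominated_by_covered)
qed

lemma X_not_dominated_C:
  assumes "x \<in> X k"
  shows "\<not> (\<exists>y\<in>C k. dominates F y x)"
  using X_not_dominated[OF assms] C_subset[of k] X_nondominated[of k] assms
  unfolding mutually_nondominated_def by blast

text \<open>Points of \<open>X k\<close> are handled by \<open>X_not_dominated_C\<close> and pairs
  in \<open>Cbar k\<close> by the filter. An added point \<open>y\<close> exceeds each point of
  \<open>Cbar k\<close> in some component, so it dominates none of them.\<close>

lemma C_nondominated: "mutually_nondominated F (C k)"
proof -
  have "\<not> dominates F y x" if x: "x \<in> C k" and y: "y \<in> C k" for x y
  proof (cases "x \<in> X k")
    case True
    then show ?thesis using X_not_dominated_C y by blast
  next
    case False
    then have xb: "x \<in> Cbar k" using x C_eq[of k] by blast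
    show ?thesis
    proof (cases "y \<in> Cbar k")
      case True
      then show ?thesis using xb by (auto simp: Cbar_def nondominated_def)
    next
      case False
      then have "\<exists>j. F x $ j < F y $ j" using y xb unfolding C_eq[of k] by simp
      then show ?thesis by (auto simp: dominates_def less_eq_vec_def not_le)
    qed
  qed
  then show ?thesis unfolding mutually_nondominated_def by blast
qed

text \<open>The extra points in the definition of \<^term>\<open>C k\<close> are exactly those \<open>x\<close> of \<^term>\<open>X k\<close> with
  \<open>F x \<le> F y\<close> for no \<open>y\<close> in \<^term>\<open>Cbar k\<close>.\<close>

lemma X_below_C:
  assumes "x \<in> X k"
  shows "\<exists>c\<in>C k. F x \<le> F c"
proof (cases "\<exists>y\<in>Cbar k. F x \<le> F y")
  case True
  then show ?thesis unfolding C_eq[of k] by blast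
next
  case False
  then have "x \<in> C k" using assms unfolding C_eq[of k] by (force simp: less_eq_vec_def not_le)
  then show ?thesis by blast
qed

section \<open>Confinement to the compact level set\<close>

text \<open>Nondominance passes from \<open>A\<close> to \<open>x0\<close> by coverage. If
  \<open>x0\<close> does not dominate \<open>x\<close>, then equal values or a smaller component of
  \<open>F x\<close> put \<open>x\<close> into one of the level sets.\<close>

lemma in_level_set:
  assumes x0: "x0 \<in> X0" and x: "x \<in> \<Omega>" and cov: "covers F A {x0}"
    and nd: "\<not> (\<exists>y\<in>A. dominates F y x)"
  shows "x \<in> (\<Union>j. {x \<in> \<Omega>. F x $ j \<le> F x0 $ j})"
proof -
  have "\<not> dominates F x0 x" using not_dominated_by_covered[OF cov nd] by simp
  then have "F x = F x0 \<or> (\<exists>j. F x $ j < F x0 $ j)"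
    by (auto simp: dominates_def less_eq_vec_def not_le)
  then show ?thesis using x by (auto intro: less_imp_le)
qed

lemma C_covers_x0:
  assumes "x0 \<in> X0"
  shows "covers F (C k) {x0}"
proof -
  have "Xl 0 = X0" using Xl_window[of 0] by (simp add: X_0)
  then have "covers F (C 0) {x0}" using C_covers[of 0] assms by (auto simp: covers_def)
  then show ?thesis using C_mono[of 0 k] covers_trans by blast
qed

lemma C_in_level_set:
  assumes "x0 \<in> X0"
  shows "C k \<subseteq> (\<Union>j. {x \<in> \<Omega>. F x $ j \<le> F x0 $ j})"
  using in_level_set[OF assms _ C_covers_x0[OF assms]] C_nondominated[of k] C_in_box[of k]
  unfolding mutually_nondominated_def by blast

lemma X_in_level_set:
  assumes "x0 \<in> X0"
  shows "X k \<subseteq> (\<Union>j. {x \<in> \<Omega>. F x $ j \<le> F x0 $ j})"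
  using in_level_set[OF assms _ C_covers_x0[OF assms]] X_not_dominated_C[of _ k] X_in_box[of k]
  by blast

section \<open>Persistent improvement contradicts boundedness\<close>

lemma C_eventually_covers:
  assumes "\<And>k. k0 \<le> k \<Longrightarrow> covers F (X (Suc k)) {z k}" and "k0 \<le> k"
  shows "\<exists>i\<in>{k..k + M}. \<forall>n\<ge>k + M + 1. covers F (C n) {z i}"
proof -
  \<comment> \<open>The window reaches back \<open>M\<close> sets, hence starts at
    \<open>k + 1\<close>. Its members are the \<open>X (Suc i)\<close> with \<open>i\<close> in
    \<open>{k..k + M}\<close>, each covering \<open>z i\<close>.\<close>
  have "Xl (k + M + 1) \<in> X ` {k + 1..k + M + 1}"
    using Xl_window[of "k + M + 1"] by simp
  then obtain p where p: "p \<in> {k + 1..k + M + 1}" "Xl (k + M + 1) = X p" by blast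
  then obtain i where i: "p = Suc i" "i \<in> {k..k + M}" by (cases p) auto
  have "covers F (C (k + M + 1)) (Xl (k + M + 1))"
    using C_covers[of "k + M + 1"] by (simp add: covers_def)
  then have "covers F (C (k + M + 1)) {z i}"
    using assms(1)[of i] assms(2) i p(2) covers_trans by fastforce
  then have "\<forall>n\<ge>k + M + 1. covers F (C n) {z i}"
    using covers_trans[OF C_mono] by blast
  then show ?thesis using i by blast
qed

text \<open>One index is picked in each block of iterations; the values of \<open>F\<close> at the
  corresponding \<open>c\<close> are \<open>\<eta>\<close>-separated, which contradicts the
  Bolzano-Weierstrass theorem.\<close>

lemma no_uniform_improvement:
  assumes bdd: "bounded (\<Union>k. F ` C k)" and \<eta>: "0 < \<eta>"
    and cov: "\<And>k. k0 \<le> k \<Longrightarrow> covers F (X (Suc k)) {z k}"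
    and c: "\<And>k. k0 \<le> k \<Longrightarrow> c k \<in> C k"
    and dec: "\<And>k j. k0 \<le> k \<Longrightarrow> F (z k) $ j \<le> F (c k) $ j - \<eta>"
  shows False
proof -
  \<comment> \<open>Blocks of length \<open>M + 1\<close>: the point \<open>z (i n)\<close> chosen
    from one block is covered by \<open>C k\<close> from the start of the next block on.\<close>
  define a where "a n = k0 + n * (M + 1)" for n
  have "\<exists>i\<in>{a n..a n + M}. \<forall>k\<ge>a n + M + 1. covers F (C k) {z i}" for n
    using C_eventually_covers[of k0 z, OF cov] by (simp add: a_def)
  then obtain i where i: "\<And>n. i n \<in> {a n..a n + M}"
    "\<And>n k. a n + M + 1 \<le> k \<Longrightarrow> covers F (C k) {z (i n)}"
    by metis
  have ik0: "k0 \<le> i n" for n using i(1)[of n] by (simp add: a_def)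
  define p where "p n = F (c (i n))" for n
  have sep: "\<eta> \<le> norm (p n' - p n)" if "n < n'" for n n'
  proof -
    have "a n + M + 1 \<le> a n'"
    proof -
      have "(n + 1) * (M + 1) \<le> n' * (M + 1)" using that by (intro mult_right_mono) auto
      then show ?thesis by (simp add: a_def)
    qed
    then have "a n + M + 1 \<le> i n'" using i(1)[of n'] by simp
    from i(2)[OF this] obtain y where y: "y \<in> C (i n')" "F y \<le> F (z (i n))"
      by (auto simp: covers_def)
    have "\<not> dominates F y (c (i n'))"
      using C_nondominated y(1) c[OF ik0] unfolding mutually_nondominated_def by blast
    \<comment> \<open>Failure to dominate means equal values or a strictly larger component of
      \<open>F y\<close>; either way such a \<open>j\<close> exists.\<close>
    then obtain j where j: "F (c (i n')) $ j \<le> F y $ j"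
      by (auto simp: dominates_def less_eq_vec_def not_le intro: less_imp_le)
    have "F y $ j \<le> F (z (i n)) $ j" using y(2) by (simp add: less_eq_vec_def)
    also have "\<dots> \<le> p n $ j - \<eta>" using dec[OF ik0] by (simp add: p_def)
    finally have "\<eta> \<le> \<bar>(p n' - p n) $ j\<bar>" using j by (simp add: p_def)
    also have "\<dots> \<le> norm (p n' - p n)" by (rule component_le_norm_cart)
    finally show ?thesis .
  qed
  have "bounded (range p)"
    using bdd by (rule bounded_subset) (use c[OF ik0] in \<open>auto simp: p_def\<close>)
  then obtain l r where r: "strict_mono r" "(p \<circ> r) \<longlonglongrightarrow> l"
    using bounded_imp_convergent_subsequence by blast
  then have "Cauchy (p \<circ> r)" by (intro LIMSEQ_imp_Cauchy)
  then obtain N where N: "\<And>m n. N \<le> m \<Longrightarrow> N \<le> n \<Longrightarrow> norm ((p \<circ> r) m - (p \<circ> r) n) < \<eta>"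
    using \<eta> by (meson CauchyD)
  have "r N < r (Suc N)" using r(1) by (simp add: strict_mono_def)
  then show False using sep N[of "Suc N" N] by fastforce
qed

text \<open>The disjunction serves constant and vanishing \<open>\<sigma>\<close> alike. Its
  negation provides both a slope bounded away from 0 and the branch of \<open>common_step\<close>
  that performs a line search.\<close>

lemma theta_not_eventually_small:
  assumes F: "continuously_differentiable F"
    and first: "\<And>k. is_arg_min (theta F \<Omega> UNIV) (\<lambda>x. x \<in> X k) (hd (ord k))"
    and x0: "x0 \<in> X0" and level: "compact (\<Union>j. {x \<in> \<Omega>. F x $ j \<le> F x0 $ j})"
    and \<epsilon>: "0 < \<epsilon>"
  shows "\<exists>k\<ge>k0. - \<epsilon> < theta F \<Omega> UNIV (hd (ord k)) \<or> - \<sigma> k \<le> theta F \<Omega> UNIV (hd (ord k))"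
proof (rule ccontr)
  assume "\<not> ?thesis"
  then have small: "theta F \<Omega> UNIV (hd (ord k)) \<le> - \<epsilon>" "theta F \<Omega> UNIV (hd (ord k)) < - \<sigma> k"
    if "k0 \<le> k" for k using that by (meson not_le)+
  let ?L = "\<Union>j. {x \<in> \<Omega>. F x $ j \<le> F x0 $ j}"
  obtain amin where amin: "0 < amin"
    "\<And>x a. x \<in> ?L \<Longrightarrow> theta F \<Omega> UNIV x \<le> - \<epsilon> \<Longrightarrow> 0 < a \<Longrightarrow> a \<le> amin \<Longrightarrow>
       F (x + a *\<^sub>R v_dir F \<Omega> UNIV x) \<le> F x + (\<gamma> * a * D_slope F x (v_dir F \<Omega> UNIV x)) *\<^sub>R 1"
    using sufficient_decrease[OF F \<Omega> level _ \<epsilon> params(6)] by blast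
  define b where "b = min \<alpha>0 (\<delta> * amin)"
  have b: "0 < b" using params amin(1) by (simp add: b_def)
  have "\<exists>z c. covers F (X (Suc k)) {z} \<and> c \<in> C k \<and> (\<forall>j. F z $ j \<le> F c $ j - \<gamma> * b * \<epsilon>)"
    if k: "k0 \<le> k" for k
  proof -
    define x where "x = hd (ord k)"
    define v where "v = v_dir F \<Omega> UNIV x"
    have xX: "x \<in> X k" using first[of k] by (simp add: is_arg_min_def x_def)
    then obtain xs where xs: "ord k = x # xs"
      using set_ord[of k] by (cases "ord k") (auto simp: x_def)
    have x\<Omega>: "x \<in> \<Omega>" and xL: "x \<in> ?L"
      using xX X_in_box X_in_level_set[OF x0] by blast+
    obtain s where s: "process_point F \<Omega> \<alpha>0 \<delta> \<gamma> (\<sigma> k) x (C k, G k) s"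
      "run_loop (process_point F \<Omega> \<alpha>0 \<delta> \<gamma> (\<sigma> k)) xs s (Xhat k, G (Suc k))"
      using loop[of k] xs by auto
    \<comment> \<open>As \<open>x\<close> comes first, it meets the unmodified working set
      \<open>C k\<close> and passes the dominance check.\<close>
    obtain \<alpha> where \<alpha>: "common_step F \<Omega> \<alpha>0 \<delta> \<gamma> (\<sigma> k) (C k) x \<alpha>"
      and cov: "covers F (fst s) {x + \<alpha> *\<^sub>R v}"
      using process_point_covers_new_point[OF s(1)] X_not_dominated_C[OF xX] by (auto simp: v_def)
    let ?z = "x + \<alpha> *\<^sub>R v"
    let ?P = "\<lambda>a. \<exists>c\<in>C k. F x \<le> F c \<and> F (x + a *\<^sub>R v) \<le> F c + (\<gamma> * a * D_slope F x v) *\<^sub>R 1"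
    have step: "largest_step \<alpha>0 \<delta> ?P \<alpha>"
      using \<alpha> small(2)[OF k] X_below_C[OF xX] by (simp add: common_step_def Let_def x_def v_def)
    then obtain c where c: "c \<in> C k" "F ?z \<le> F c + (\<gamma> * \<alpha> * D_slope F x v) *\<^sub>R 1"
      by (auto simp: largest_step_def)
    \<comment> \<open>For \<open>c\<close> with \<open>F x \<le> F c\<close>, sufficient decrease
      relative to \<open>x\<close> implies it relative to \<open>c\<close>, so the threshold
      \<open>amin\<close> applies.\<close>
    have "?P a" if "0 < a" "a \<le> amin" for a
      using amin(2)[OF xL _ that] small(1)[OF k] X_below_C[OF xX]
      unfolding x_def[symmetric] v_def[symmetric] by (meson add_right_mono order_trans)
    then have "b \<le> \<alpha>"
      unfolding b_def using largest_step_lower_bound[OF step params(1,3,4)] by blast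
    have "theta F \<Omega> UNIV x = D_slope F x v + 1/2 * (norm v)\<^sup>2"
      using theta_eq_dir_objective[OF \<Omega> x\<Omega>, of UNIV F] by (simp add: dir_objective_def v_def)
    moreover have "theta F \<Omega> UNIV x \<le> - \<epsilon>" using small(1)[OF k] by (simp add: x_def)
    ultimately have "D_slope F x v \<le> - \<epsilon>"
      using zero_le_power2[of "norm v"] by linarith
    then have "\<gamma> * \<alpha> * D_slope F x v \<le> \<gamma> * \<alpha> * - \<epsilon>"
      using params b \<open>b \<le> \<alpha>\<close> by (intro mult_left_mono) auto
    also have "\<dots> \<le> - (\<gamma> * b * \<epsilon>)"
      using \<epsilon> params \<open>b \<le> \<alpha>\<close> by (simp add: mult_right_mono mult_left_mono)
    finally have le: "\<gamma> * \<alpha> * D_slope F x v \<le> - (\<gamma> * b * \<epsilon>)" .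
    have dec: "\<forall>j. F ?z $ j \<le> F c $ j - \<gamma> * b * \<epsilon>"
    proof
      fix j
      have "F ?z $ j \<le> F c $ j + \<gamma> * \<alpha> * D_slope F x v"
        using c(2) by (simp add: less_eq_vec_def)
      then show "F ?z $ j \<le> F c $ j - \<gamma> * b * \<epsilon>" using le by linarith
    qed
    \<comment> \<open>Processing the remaining points may delete \<open>?z\<close>, but the working
      set keeps covering it.\<close>
    let ?Q = "\<lambda>s. finite (fst s) \<and> fst s \<subseteq> \<Omega> \<and> covers F (fst s) {?z}"
    have "?Q (Xhat k, G (Suc k))"
    proof (rule run_loop_invariant[where P = ?Q, OF s(2)])
      show "?Q s"
        using process_point_invariant[OF \<Omega> params(1-4) x\<Omega> s(1)] finite_C C_in_box cov by simp
      show "?Q t'" if "y \<in> set xs" "process_point F \<Omega> \<alpha>0 \<delta> \<gamma> (\<sigma> k) y t t'" "?Q t" for y t t'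
      proof -
        have "y \<in> \<Omega>" using that(1) xs set_ord[of k] X_in_box[of k] by auto
        from process_point_invariant[OF \<Omega> params(1-4) this that(2)] that(3)
        show ?thesis using covers_trans by blast
      qed
    qed
    then have "covers F (X (Suc k)) {?z}" using covers_trans[OF X_covers_Xhat] by simp
    then show ?thesis using c(1) dec by blast
  qed
  then obtain z c where zc: "\<And>k. k0 \<le> k \<Longrightarrow> covers F (X (Suc k)) {z k}"
    "\<And>k. k0 \<le> k \<Longrightarrow> c k \<in> C k" "\<And>k j. k0 \<le> k \<Longrightarrow> F (z k) $ j \<le> F (c k) $ j - \<gamma> * b * \<epsilon>"
    by metis
  have "continuous_on ?L F"
    using F unfolding continuously_differentiable_def
    by (meson has_derivative_continuous continuous_at_imp_continuous_on)
  then have "bounded (F ` ?L)" using level by (intro compact_imp_bounded compact_continuous_image)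
  moreover have "(\<Union>k. F ` C k) \<subseteq> F ` ?L" using C_in_level_set[OF x0] by blast
  ultimately have "bounded (\<Union>k. F ` C k)" by (rule bounded_subset)
  from no_uniform_improvement[OF this _ zc] show False using params b \<epsilon> by simp
qed

end

section \<open>Boxes, extraction of a subsequence, and the conclusion\<close>

lemma closed_ext_box:
  fixes l u :: "'n::finite \<Rightarrow> ereal"
  shows "closed (ext_box l u)"
proof -
  have "ext_box l u = (\<Inter>i. {x. l i \<le> ereal (x $ i)} \<inter> {x. ereal (x $ i) \<le> u i})"
    by (auto simp: ext_box_def)
  moreover have "closed {x::real^'n. l i \<le> ereal (x $ i)}" "closed {x::real^'n. ereal (x $ i) \<le> u i}" for i
    by (intro closed_Collect_le continuous_intros)+
  ultimately show ?thesis by (simp add: closed_INT closed_Int)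
qed

lemma convex_ext_box: "convex (ext_box l u)"
proof -
  have "convex {t. l i \<le> ereal t \<and> ereal t \<le> u i}" for i
    unfolding is_interval_convex_1[symmetric] is_interval_1
    by (metis (mono_tags, lifting) ereal_less_eq(3) mem_Collect_eq order_trans)
  then have "(1 - t) *\<^sub>R a + t *\<^sub>R b \<in> {t. l i \<le> ereal t \<and> ereal t \<le> u i}"
    if "a \<in> {t. l i \<le> ereal t \<and> ereal t \<le> u i}" "b \<in> {t. l i \<le> ereal t \<and> ereal t \<le> u i}"
      "0 \<le> t" "t \<le> 1" for a b t i
    using that unfolding convex_alt by blast
  then show ?thesis by (simp add: convex_alt ext_box_def)
qed

text \<open>Increasing indices are chosen recursively with error below \<open>1 / Suc n\<close>; the
  upper bound \<open>l\<close> turns this one-sided estimate into convergence.\<close>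

lemma ex_infinite_tendsto:
  fixes f :: "nat \<Rightarrow> real"
  assumes le: "\<And>k. f k \<le> l" and freq: "\<And>e k0. 0 < e \<Longrightarrow> \<exists>k\<ge>k0. l - e < f k"
  shows "\<exists>K. infinite K \<and> (f \<longlongrightarrow> l) (inf sequentially (principal K))"
proof -
  have "\<exists>r::nat \<Rightarrow> nat. \<forall>n. l - 1 / Suc n < f (r n) \<and> r n < r (Suc n)"
  proof (rule dependent_nat_choice)
    show "\<exists>k. l - 1 / Suc 0 < f k" using freq[of 1 0] by auto
    show "\<exists>k'. l - 1 / Suc (Suc n) < f k' \<and> k < k'" for k n
      using freq[of "1 / Suc (Suc n)" "Suc k"] by (auto simp: Suc_le_eq)
  qed
  then obtain r :: "nat \<Rightarrow> nat" where r: "\<And>n. l - 1 / Suc n < f (r n)" "strict_mono r"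
    by (auto simp: strict_mono_Suc_iff)
  have "(f \<longlongrightarrow> l) (inf sequentially (principal (range r)))"
  proof (rule tendstoI)
    fix e :: real assume "0 < e"
    then obtain N where N: "1 / Suc N < e" using nat_approx_posE by metis
    have "dist (f (r n)) l < e" if "r N \<le> r n" for n
    proof -
      have "N \<le> n" using that r(2) by (simp add: strict_mono_less_eq)
      then have "1 / Suc n \<le> 1 / real (Suc N)" by (intro divide_left_mono) auto
      then show ?thesis using r(1)[of n] le[of "r n"] N by (simp add: dist_real_def)
    qed
    then show "\<forall>\<^sub>F k in inf sequentially (principal (range r)). dist (f k) l < e"
      unfolding eventually_inf_principal eventually_sequentially by (auto intro!: exI[of _ "r N"])
  qed
  moreover have "infinite (range r)"
    using r(2) by (simp add: strict_mono_imp_inj_on range_inj_infinite)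
  ultimately show ?thesis by blast
qed

theorem theorem1:
  fixes F :: "real^'n \<Rightarrow> real^'m"
    and l u :: "'n \<Rightarrow> ereal" and \<Omega> :: "(real^'n) set"
    and \<alpha>0 \<delta> \<gamma> :: real and \<sigma> :: "nat \<Rightarrow> real" and M :: nat
    and X0 :: "(real^'n) set"
    and X Xl C Xhat Xbl G :: "nat \<Rightarrow> (real^'n) set" and ord :: "nat \<Rightarrow> (real^'n) list"
  assumes F: "continuously_differentiable F"
    and box: "\<Omega> = ext_box l u" "\<Omega> \<noteq> {}"
    and params: "0 < \<alpha>0" "\<alpha>0 \<le> 1" "0 < \<delta>" "\<delta> < 1" "0 < \<gamma>" "\<gamma> < 1" "\<And>k. 0 \<le> \<sigma> k" "0 < M"
    and X0: "finite X0" "X0 \<subseteq> \<Omega>" "mutually_nondominated F X0"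
    and run: "FPD_NMT_run F \<Omega> \<alpha>0 \<delta> \<gamma> \<sigma> M X0 X Xl C ord Xhat Xbl G"
    and same_worst_set: "\<And>k. k > 0 \<Longrightarrow> Xbl (k - 1) = Xl k"
    and processing_order: "\<And>k. is_arg_min (theta F \<Omega> UNIV) (\<lambda>x. x \<in> X k) (hd (ord k))"
    and level_set: "\<exists>x0\<in>X0. compact (\<Union>j. {x \<in> \<Omega>. F x $ j \<le> F x0 $ j})"
  shows "\<exists>K :: nat set. infinite K \<and>
    (\<forall>s>0. (\<forall>k. \<sigma> k = s) \<longrightarrow> (\<exists>kbar\<in>K. \<forall>k\<in>K. k \<ge> kbar \<longrightarrow> set_theta F \<Omega> (X k) \<ge> - s)) \<and>
    (\<sigma> \<longlonglongrightarrow> 0 \<longrightarrow> ((\<lambda>k. set_theta F \<Omega> (X k)) \<longlongrightarrow> 0) (inf sequentially (principal K)))"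
proof -
  have \<Omega>: "closed \<Omega>" "convex \<Omega>" by (simp_all add: box closed_ext_box convex_ext_box)
  interpret FPD_NMT F \<Omega> \<alpha>0 \<delta> \<gamma> \<sigma> M X0 X Xl C Xhat Xbl G ord
    using \<Omega> params X0 run same_worst_set[of "Suc _"] by unfold_locales auto
  obtain x0 where x0: "x0 \<in> X0" "compact (\<Union>j. {x \<in> \<Omega>. F x $ j \<le> F x0 $ j})"
    using level_set by blast
  have first: "hd (ord k) \<in> X k" for k using processing_order[of k] by (simp add: is_arg_min_def)
  \<comment> \<open>By the processing order the infimum is attained at the first processed
    point.\<close>
  have Th: "set_theta F \<Omega> (X k) = theta F \<Omega> UNIV (hd (ord k))" for k
    unfolding set_theta_def using processing_order[of k]
    by (intro cInf_eq_minimum) (auto simp: is_arg_min_def not_less)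
  have nonpos: "set_theta F \<Omega> (X k) \<le> 0" for k
    using theta_nonpos[OF \<Omega>, of "hd (ord k)" UNIV F] first[of k] X_in_box[of k] Th[of k] by auto
  note freq = theta_not_eventually_small[OF F processing_order x0, folded Th]
  show ?thesis
  \<comment> \<open>One \<open>K\<close> must serve both claims. A positive constant does not tend
    to 0, so at most one premise holds and \<open>K\<close> can be chosen accordingly.\<close>
  proof (cases "\<sigma> \<longlonglongrightarrow> 0")
    case True
    have "\<exists>k\<ge>k0. 0 - e < set_theta F \<Omega> (X k)" if e: "0 < e" for e k0
    proof -
      obtain k1 where k1: "\<And>k. k1 \<le> k \<Longrightarrow> \<sigma> k < e"
        using order_tendstoD(2)[OF True e] by (auto simp: eventually_sequentially)
      \<comment> \<open>Beyond \<open>k1\<close>, both alternatives give a value above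
        \<open>- e\<close>, because \<open>\<sigma> k < e\<close>.\<close>
      obtain k where "max k0 k1 \<le> k"
        "- e < set_theta F \<Omega> (X k) \<or> - \<sigma> k \<le> set_theta F \<Omega> (X k)"
        using freq[OF e] by blast
      then show ?thesis using k1[of k] by (intro exI[of _ k]) auto
    qed
    from ex_infinite_tendsto[of "\<lambda>k. set_theta F \<Omega> (X k)", OF nonpos this]
    obtain K where "infinite K"
      "((\<lambda>k. set_theta F \<Omega> (X k)) \<longlongrightarrow> 0) (inf sequentially (principal K))"
      by blast
    moreover have "\<not> (\<forall>k. \<sigma> k = s)" if "0 < s" for s
    proof
      assume "\<forall>k. \<sigma> k = s"
      then have "\<sigma> = (\<lambda>_. s)" by blast
      then show False using True that by (simp add: LIMSEQ_const_iff)
    qed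
    ultimately show ?thesis by blast
  next
    case False
    show ?thesis
    proof (cases "\<exists>s>0. \<forall>k. \<sigma> k = s")
      case True
      then obtain s where s: "0 < s" "\<And>k. \<sigma> k = s" by blast
      define K where "K = {k. - s \<le> set_theta F \<Omega> (X k)}"
      \<comment> \<open>With \<open>\<epsilon>\<close> equal to \<open>s\<close>, both alternatives
        in \<open>freq\<close> place the index in \<open>K\<close>.\<close>
      have "\<exists>k\<ge>k0. k \<in> K" for k0
        using freq[OF s(1), of k0] s(2) by (force simp: K_def)
      then have "infinite K" by (simp add: infinite_nat_iff_unbounded_le)
      then show ?thesis
        using False s(2) infinite_imp_nonempty[of K] by (intro exI[of _ K]) (auto simp: K_def)
    next
      case nonconst: False
      \<comment> \<open>Neither premise holds, so any infinite set of indices will do.\<close>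
      show ?thesis using False nonconst by (intro exI[of _ UNIV]) auto
    qed
  qed
qed

end
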